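(* Let $(S,G)$ be a combinatorial surface and let $\mathbf{F}$ be a combinatorial vector field (CVF) on $(S,G)$. The following are equivalent: (1) For all embedded edge loops $\phi$ in $G$, $\oint_{\phi} \mathbf{F} = 0$. (2) For all edge loops $\phi$ in $G$, $\oint_{\phi} \mathbf{F} = 0$. (3) If $\phi$ and $\psi$ are two edge paths in $G$, each joining a vertex $v$ to a vertex $w$, then $\oint_\phi \mathbf{F} = \oint_{\psi} \mathbf{F}$. (4) There is a vertex scalar field $f$ on $(S,G)$ such that $\mathbf{F} \bumpeq \operatorname{tilt} f$.
   Context: A combinatorial surface $(S,G)$ consists of a compact smooth surface $S \subset \mathbb{R}^n$ (possibly with boundary) and a graph $G$ embedded in $S$. The graph consists of finitely many vertices $\mathcal{V}$ (points of $S$); finitely many edges $\mathcal{E}$, each an embedded C$^1$ curve with endpoints on vertices (loops are allowed; edges meet only at vertices); and faces $\mathcal{F}$, each the closure of a component of $S - (\bigcup \mathcal{V} \cup \bigcup \mathcal{E})$. It is required that: each face is homeomorphic to a disc; each vertex is the endpoint of at least one edge; $\partial S \subset \bigcup \mathcal{E}$; each edge not contained in $\partial S$ lies in the boundary of two distinct faces. An orientation of an edge is a choice of direction along it; the edge points out of its source vertex and into its sink vertex (for a loop edge these coincide). A (nonempty) finite sequence of oriented edges $e_1,\dots,e_n$ is an edge path if, for each $1\le i<n$, the sink of $e_i$ is the source of $e_{i+1}$; it joins the source of $e_1$ to the sink of $e_n$. It is an edge loop if moreover the sink of $e_n$ is the source of $e_1$. An edge path is embedded if, for all $i$, $e_i$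 and $e_{i+1}$ are distinct edges of $G$ (regardless of orientation) and no vertex is the sink of more than one edge in the sequence. A vertex scalar field (VSF) is a function $f\colon\mathcal{V}\to\mathbb{R}$. A combinatorial vector field (CVF) $\mathbf{F}$ is a choice of orientation on each edge together with a function $\mathbf{F}\colon\mathcal{E}\to\mathbb{R}$. For two CVFs $\mathbf{F},\mathbf{G}$, write $\mathbf{F}\bumpeq\mathbf{G}$ if $\mathbf{F}(e)=\mathbf{G}(e)$ whenever $\mathbf{F}$ and $\mathbf{G}$ assign the same orientation to $e$, and $\mathbf{F}(e)=-\mathbf{G}(e)$ whenever they assign opposite orientations to $e$. For an oriented edge $e$, let $\epsilon(e,\mathbf{F})=+1$ if the orientation of $e$ agrees with the one given by $\mathbf{F}$ and $-1$ otherwise. For an edge path $\phi=e_1,\dots,e_n$, $\oint_\phi\mathbf{F}=\sum_{i=1}^n\epsilon(e_i,\mathbf{F})\mathbf{F}(e_i)$ (a combinatorial integral, i.e. a finite sum; $\phi$ need not be closed). For a VSF $f$, $\operatorname{tilt} f$ is the CVF defined as follows: if $e$ has endpoints $v,w$ with $f(v)\le f(w)$, then $\operatorname{tilt} f$ orients $e$ from $v$ to $w$ and $\operatorname{tilt} f(e)=f(w)-f(v)$ (if $f(v)=f(w)$ either orientation may be chosen, and $\operatorname{tilt} f(e)=0$). *)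

theory Defs
  imports "HOL-Analysis.Analysis"
begin

section \<open>Smooth surfaces with boundary in Euclidean space\<close>

text \<open>The clauses below express \<open>C\<^sup>k\<close> on an open set \<open>U\<close>: all directional derivatives
  are required to be \<open>C\<^sup>k\<^sup>-\<^sup>1\<close>. On a non-open set, a map is smooth if it extends locally to
  a smooth map on an open subset of the ambient space.\<close>

primrec Ck_on_open ::
  "nat \<Rightarrow> 'a::euclidean_space set \<Rightarrow> ('a \<Rightarrow> 'b::euclidean_space) \<Rightarrow> bool" where
  "Ck_on_open 0 U f \<longleftrightarrow> continuous_on U f"
| "Ck_on_open (Suc k) U f \<longleftrightarrow>
     (\<forall>x\<in>U. f differentiable (at x)) \<and>
     (\<forall>v. Ck_on_open k U (\<lambda>x. frechet_derivative f (at x) v))"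

definition smooth_map_on ::
  "'a::euclidean_space set \<Rightarrow> ('a \<Rightarrow> 'b::euclidean_space) \<Rightarrow> bool" where
  "smooth_map_on X f \<longleftrightarrow>
     (\<forall>x\<in>X. \<exists>U g. open U \<and> x \<in> U \<and> (\<forall>k. Ck_on_open k U g) \<and> (\<forall>y\<in>U \<inter> X. g y = f y))"

definition half_plane :: "(real^2) set" where
  "half_plane = {x. 0 \<le> x $ 2}"

definition surface_chart ::
  "(real^'n) set \<Rightarrow> (real^2) set \<Rightarrow> (real^'n) set \<Rightarrow> (real^2 \<Rightarrow> real^'n) \<Rightarrow> (real^'n \<Rightarrow> real^2) \<Rightarrow> bool"
where
  "surface_chart S D W h k \<longleftrightarrow>
     openin (top_of_set half_plane) D \<and> openin (top_of_set S) W \<and>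
     homeomorphism D W h k \<and> smooth_map_on D h \<and> smooth_map_on W k"

definition compact_smooth_surface :: "(real^'n) set \<Rightarrow> bool" where
  "compact_smooth_surface S \<longleftrightarrow>
     compact S \<and> (\<forall>p\<in>S. \<exists>D W h k. surface_chart S D W h k \<and> p \<in> W)"

definition surface_boundary :: "(real^'n) set \<Rightarrow> (real^'n) set" where
  "surface_boundary S =
     {p. \<exists>D W h k x. surface_chart S D W h k \<and> x \<in> D \<and> x $ 2 = 0 \<and> h x = p}"


section \<open>Combinatorial surfaces\<close>

text \<open>Edges are given as parametrized curves on \<open>[0,1]\<close>. The parametrization serves as
  the reference direction of the edge; it makes the two directions of a loop edge
  distinguishable. The condition on meeting only at vertices ensures that distinct members of the
  edge set have distinct images.\<close>

type_synonym 'n curve = "real \<Rightarrow> real^'n"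

text \<open>A simple path may be closed, which permits loop edges; a closed edge may have a
  corner at its vertex.\<close>

definition embedded_C1_curve :: "('n::finite) curve \<Rightarrow> bool" where
  "embedded_C1_curve \<gamma> \<longleftrightarrow>
     simple_path \<gamma> \<and>
     (\<exists>\<gamma>'. continuous_on {0..1} \<gamma>' \<and>
        (\<forall>t\<in>{0..1}. (\<gamma> has_vector_derivative \<gamma>' t) (at t within {0..1}) \<and> \<gamma>' t \<noteq> 0))"

definition faces :: "(real^'n) set \<Rightarrow> (real^'n) set \<Rightarrow> 'n curve set \<Rightarrow> (real^'n) set set" where
  "faces S V E = closure ` components (S - (V \<union> (\<Union>e\<in>E. path_image e)))"

text \<open>The boundary circle of a closed disc (by invariance of domain it does not depend on
  the homeomorphism).\<close>

definition disc_boundary :: "(real^'n) set \<Rightarrow> (real^'n) set" where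
  "disc_boundary A =
     {p. \<exists>h k. homeomorphism (cball (0::real^2) 1) A h k \<and> p \<in> h ` sphere 0 1}"

definition combinatorial_surface ::
  "(real^'n) set \<Rightarrow> (real^'n) set \<Rightarrow> 'n curve set \<Rightarrow> bool" where
  "combinatorial_surface S V E \<longleftrightarrow>
     compact_smooth_surface S \<and>
     finite V \<and> V \<subseteq> S \<and>
     finite E \<and>
     (\<forall>e\<in>E. embedded_C1_curve e \<and> path_image e \<subseteq> S \<and>
        path_image e \<inter> V = {pathstart e, pathfinish e}) \<and>
     (\<forall>e\<in>E. \<forall>e'\<in>E. e \<noteq> e' \<longrightarrow> path_image e \<inter> path_image e' \<subseteq> V) \<and>
     (\<forall>A\<in>faces S V E. A homeomorphic cball (0::real^2) 1) \<and>
     (\<forall>v\<in>V. \<exists>e\<in>E. v = pathstart e \<or> v = pathfinish e) \<and>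
     surface_boundary S \<subseteq> (\<Union>e\<in>E. path_image e) \<and>
     (\<forall>e\<in>E. \<not> path_image e \<subseteq> surface_boundary S \<longrightarrow>
        (\<exists>A\<in>faces S V E. \<exists>B\<in>faces S V E. A \<noteq> B \<and>
           path_image e \<subseteq> disc_boundary A \<and> path_image e \<subseteq> disc_boundary B))"


section \<open>Edge paths\<close>

datatype direction = Along | Against

type_synonym 'n oriented_edge = "'n curve \<times> direction"

fun source :: "('n::finite) oriented_edge \<Rightarrow> real^'n" where
  "source (e, Along) = pathstart e"
| "source (e, Against) = pathfinish e"

fun sink :: "('n::finite) oriented_edge \<Rightarrow> real^'n" where
  "sink (e, Along) = pathfinish e"
| "sink (e, Against) = pathstart e"

definition edge_path :: "('n::finite) curve set \<Rightarrow> 'n oriented_edge list \<Rightarrow> bool" where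
  "edge_path E \<phi> \<longleftrightarrow>
     \<phi> \<noteq> [] \<and> fst ` set \<phi> \<subseteq> E \<and>
     (\<forall>i. Suc i < length \<phi> \<longrightarrow> sink (\<phi> ! i) = source (\<phi> ! Suc i))"

definition joins :: "('n::finite) oriented_edge list \<Rightarrow> real^'n \<Rightarrow> real^'n \<Rightarrow> bool" where
  "joins \<phi> v w \<longleftrightarrow> source (hd \<phi>) = v \<and> sink (last \<phi>) = w"

definition edge_loop :: "('n::finite) curve set \<Rightarrow> 'n oriented_edge list \<Rightarrow> bool" where
  "edge_loop E \<phi> \<longleftrightarrow> edge_path E \<phi> \<and> sink (last \<phi>) = source (hd \<phi>)"

definition embedded :: "('n::finite) oriented_edge list \<Rightarrow> bool" where
  "embedded \<phi> \<longleftrightarrow>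
     (\<forall>i. Suc i < length \<phi> \<longrightarrow> fst (\<phi> ! i) \<noteq> fst (\<phi> ! Suc i)) \<and>
     distinct (map sink \<phi>)"


section \<open>Combinatorial vector fields\<close>

text \<open>Scalar and vector fields are total functions; only their values on the vertices and
  edges of the graph are ever used.\<close>

record ('n::finite) cvf =
  orientation :: "'n curve \<Rightarrow> direction"
  strength :: "'n curve \<Rightarrow> real"

definition cvf_equiv :: "('n::finite) curve set \<Rightarrow> 'n cvf \<Rightarrow> 'n cvf \<Rightarrow> bool" where
  "cvf_equiv E F G \<longleftrightarrow>
     (\<forall>e\<in>E. (orientation F e = orientation G e \<longrightarrow> strength F e = strength G e) \<and>
            (orientation F e \<noteq> orientation G e \<longrightarrow> strength F e = - strength G e))"

fun agreement_sign :: "('n::finite) oriented_edge \<Rightarrow> 'n cvf \<Rightarrow> real" where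
  "agreement_sign (e, d) F = (if d = orientation F e then 1 else -1)"

definition path_integral :: "('n::finite) cvf \<Rightarrow> 'n oriented_edge list \<Rightarrow> real" where
  "path_integral F \<phi> = (\<Sum>a\<leftarrow>\<phi>. agreement_sign a F * strength F (fst a))"

text \<open>The tilt of \<open>f\<close> is only determined up to the orientation of edges whose endpoints
  have equal \<open>f\<close>-values, so it is rendered as the predicate of being a tilt of \<open>f\<close>.
  For such edges both orientations satisfy the inequality and the value is 0.\<close>

definition is_tilt :: "('n::finite) curve set \<Rightarrow> (real^'n \<Rightarrow> real) \<Rightarrow> 'n cvf \<Rightarrow> bool" where
  "is_tilt E f T \<longleftrightarrow>
     (\<forall>e\<in>E. let v = source (e, orientation T e); w = sink (e, orientation T e)
             in f v \<le> f w \<and> strength T e = f w - f v)"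

end

theory Submission
  imports Defs
begin

text \<open>This is the discrete analogue of the fact that a field is conservative iff its circulations
  vanish, and the argument takes place in the graph.

  The integral is additive under concatenation and changes sign under reversal. Hence vanishing
  on all loops gives path independence (run along one path and return along the other; see
  \<open>path_independent_if_loops_vanish\<close>), and path independence gives vanishing on loops (a loop and
  the same loop run twice have the same end points). If integrals depend only on end points,
  integration from a base point chosen in each connected component yields a potential
  (\<open>potential_exists\<close>); conversely, in the presence of a potential the integral telescopes to the
  difference of its end values (\<open>path_integral_potential\<close>). Potentials are the same thing as
  tilts up to the choice of edge directions (\<open>tilt_iff_potential\<close>).

  The remaining step reduces arbitrary loops to embedded ones (\<open>loops_vanish_if_embedded_vanish\<close>).
  If a loop has two equal sinks, it can be cut there into two shorter loops with the same total
  integral. A loop with distinct sinks that is still not embedded must traverse some edge and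
  then immediately return along it; distinctness of the sinks then leaves no room for any other
  edge, so that its integral is trivially zero.\<close>

section \<open>Concatenation and reversal of edge paths\<close>

lemma edge_path_iff_successively:
  "edge_path E \<phi> \<longleftrightarrow>
     \<phi> \<noteq> [] \<and> fst ` set \<phi> \<subseteq> E \<and> successively (\<lambda>a b. sink a = source b) \<phi>"
  by (auto simp: edge_path_def successively_conv_nth)

lemma embedded_iff_successively:
  "embedded \<phi> \<longleftrightarrow> successively (\<lambda>a b. fst a \<noteq> fst b) \<phi> \<and> distinct (map sink \<phi>)"
  by (auto simp: embedded_def successively_conv_nth)

lemma edge_path_append:
  assumes "\<phi> \<noteq> []" "\<psi> \<noteq> []"
  shows "edge_path E (\<phi> @ \<psi>) \<longleftrightarrow>
           edge_path E \<phi> \<and> edge_path E \<psi> \<and> sink (last \<phi>) = source (hd \<psi>)"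
  using assms by (auto simp: edge_path_iff_successively successively_append_iff)

lemma edge_path_single: "edge_path E [a] \<longleftrightarrow> fst a \<in> E"
  by (simp add: edge_path_iff_successively)

lemma edge_path_nonempty: "edge_path E \<phi> \<Longrightarrow> \<phi> \<noteq> []"
  by (simp add: edge_path_def)

lemma joins_append:
  "\<lbrakk>\<phi> \<noteq> []; \<psi> \<noteq> []; joins \<phi> u v; joins \<psi> v w\<rbrakk> \<Longrightarrow> joins (\<phi> @ \<psi>) u w"
  by (simp add: joins_def)

lemma edge_path_join:
  assumes "edge_path E \<phi>" "joins \<phi> u v" "edge_path E \<psi>" "joins \<psi> v w"
  shows "edge_path E (\<phi> @ \<psi>)" "joins (\<phi> @ \<psi>) u w"
  using assms
  by (auto simp: edge_path_append edge_path_nonempty joins_append) (auto simp: joins_def)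

lemma edge_loop_iff_joins: "edge_loop E \<phi> \<longleftrightarrow> edge_path E \<phi> \<and> (\<exists>v. joins \<phi> v v)"
  by (auto simp: edge_loop_def joins_def)

lemma path_integral_append: "path_integral F (\<phi> @ \<psi>) = path_integral F \<phi> + path_integral F \<psi>"
  by (simp add: path_integral_def)

fun reverse_edge :: "('n::finite) oriented_edge \<Rightarrow> 'n oriented_edge" where
  "reverse_edge (e, Along) = (e, Against)"
| "reverse_edge (e, Against) = (e, Along)"

lemma reverse_edge_simps [simp]:
  "fst (reverse_edge a) = fst a"
  "source (reverse_edge a) = sink a"
  "sink (reverse_edge a) = source a"
  by (cases a rule: reverse_edge.cases; simp)+

lemma same_edge_cases: "fst a = fst b \<Longrightarrow> b = a \<or> b = reverse_edge a"
  by (cases a rule: reverse_edge.cases; cases b rule: reverse_edge.cases) auto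

lemma agreement_sign_reverse: "agreement_sign (reverse_edge a) F = - agreement_sign a F"
  by (cases a rule: reverse_edge.cases) (auto, (metis direction.exhaust)+)

definition reverse_path :: "('n::finite) oriented_edge list \<Rightarrow> 'n oriented_edge list" where
  "reverse_path \<phi> = rev (map reverse_edge \<phi>)"

lemma edge_path_reverse:
  assumes "edge_path E \<phi>"
  shows "edge_path E (reverse_path \<phi>)"
proof -
  have "successively (\<lambda>a b. source b = sink a) \<phi>"
    using assms by (simp add: edge_path_iff_successively eq_commute[of "source _"])
  then show ?thesis
    using assms
    by (auto simp: edge_path_iff_successively reverse_path_def rev_map successively_map)
qed

lemma joins_reverse: "\<phi> \<noteq> [] \<Longrightarrow> joins \<phi> v w \<Longrightarrow> joins (reverse_path \<phi>) w v"
  by (simp add: joins_def reverse_path_def hd_rev last_rev hd_map last_map)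

lemma path_integral_reverse: "path_integral F (reverse_path \<phi>) = - path_integral F \<phi>"
  by (induction \<phi>) (simp_all add: path_integral_def reverse_path_def agreement_sign_reverse)


section \<open>Reduction to embedded loops\<close>

lemma not_successively_decomp:
  "\<not> successively P xs \<Longrightarrow> \<exists>ys a b zs. xs = ys @ a # b # zs \<and> \<not> P a b"
proof (induction xs rule: induct_list012)
  case (3 x y zs)
  show ?case
  proof (cases "P x y")
    case True
    then obtain ys a b zs' where "y # zs = ys @ a # b # zs'" "\<not> P a b"
      using 3 by auto
    then have "x # y # zs = (x # ys) @ a # b # zs' \<and> \<not> P a b" by simp
    then show ?thesis by blast
  next
    case False
    then have "x # y # zs = [] @ x # y # zs \<and> \<not> P x y" by simp
    then show ?thesis by blast
  qed
qed auto

text \<open>Backtracking along an edge \<open>a\<close> returns to \<open>source a\<close>. Any preceding edge also ends at that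
  point, and by closedness so does the last edge of the loop; distinct sinks therefore exclude
  both predecessors and successors.\<close>

lemma backtracking_loop:
  assumes loop: "edge_loop E \<phi>" and dist: "distinct (map sink \<phi>)"
    and nemb: "\<not> embedded \<phi>"
  obtains a where "\<phi> = [a, reverse_edge a]"
proof -
  obtain ys a b zs where \<phi>: "\<phi> = ys @ a # b # zs" and ab: "fst a = fst b"
    using nemb dist not_successively_decomp[of "\<lambda>a b. fst a \<noteq> fst b" \<phi>]
    by (auto simp: embedded_iff_successively)
  have "b \<noteq> a" using dist by (auto simp: \<phi>)
  then have b: "b = reverse_edge a" using same_edge_cases[OF ab] by simp
  have "ys = []"
  proof (rule ccontr)
    assume "ys \<noteq> []"
    then have "sink (last ys) = source a"
      using loop edge_path_append[of ys "a # b # zs" E] by (simp add: edge_loop_def \<phi>)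
    moreover have "sink (last ys) \<in> sink ` set ys" using \<open>ys \<noteq> []\<close> by simp
    ultimately show False using dist by (auto simp: \<phi> b)
  qed
  moreover have "zs = []"
  proof (rule ccontr)
    assume "zs \<noteq> []"
    then have "sink (last zs) = source a"
      using loop \<open>ys = []\<close> by (simp add: edge_loop_def \<phi>)
    moreover have "sink (last zs) \<in> sink ` set zs" using \<open>zs \<noteq> []\<close> by simp
    ultimately show False using dist by (auto simp: \<phi> b)
  qed
  ultimately show thesis using that \<phi> b by simp
qed

text \<open>Between two visits to the same vertex a loop makes a detour that is itself a loop. Splitting
  at sinks keeps both parts nonempty: the edges with the repeated sink lie in different parts.\<close>

lemma split_loop:
  assumes loop: "edge_loop E \<phi>" and rep: "\<not> distinct (map sink \<phi>)"
  obtains \<psi> \<theta> where "edge_loop E \<psi>" "edge_loop E \<theta>"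
    "length \<psi> < length \<phi>" "length \<theta> < length \<phi>"
    "path_integral F \<phi> = path_integral F \<psi> + path_integral F \<theta>"
proof -
  obtain xs ys zs y where "map sink \<phi> = xs @ [y] @ ys @ [y] @ zs"
    using not_distinct_decomp[OF rep] by blast
  then obtain \<alpha> a \<beta> b \<gamma> where \<phi>: "\<phi> = (\<alpha> @ [a]) @ (\<beta> @ [b]) @ \<gamma>" and ab: "sink a = sink b"
    by (auto simp: map_eq_append_conv append_eq_map_conv map_eq_Cons_conv Cons_eq_map_conv)
  have "edge_path E (\<alpha> @ [a])" and rest: "edge_path E ((\<beta> @ [b]) @ \<gamma>)"
    and mid: "sink a = source (hd (\<beta> @ [b]))"
    using loop edge_path_append[of "\<alpha> @ [a]" "(\<beta> @ [b]) @ \<gamma>" E]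
    by (auto simp: edge_loop_def \<phi> hd_append)
  have "edge_loop E (\<beta> @ [b])"
    using rest mid ab edge_path_append[of "\<beta> @ [b]" \<gamma> E]
    by (cases "\<gamma> = []") (auto simp: edge_loop_def)
  moreover have "edge_loop E ((\<alpha> @ [a]) @ \<gamma>)"
  proof (cases "\<gamma> = []")
    case True
    then show ?thesis
      using loop ab \<open>edge_path E (\<alpha> @ [a])\<close> by (auto simp: edge_loop_def \<phi> hd_append)
  next
    case False
    then show ?thesis
      using loop ab \<open>edge_path E (\<alpha> @ [a])\<close> rest
        edge_path_append[of "\<beta> @ [b]" \<gamma> E] edge_path_append[of "\<alpha> @ [a]" \<gamma> E]
      by (auto simp: edge_loop_def \<phi> hd_append)
  qed
  ultimately show thesis
    by (rule that) (simp_all add: \<phi> path_integral_append path_integral_def)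
qed

lemma loops_vanish_if_embedded_vanish:
  assumes emb: "\<And>\<phi>. edge_loop E \<phi> \<Longrightarrow> embedded \<phi> \<Longrightarrow> path_integral F \<phi> = 0"
    and "edge_loop E \<phi>"
  shows "path_integral F \<phi> = 0"
  using assms(2)
proof (induction \<phi> rule: length_induct)
  case (1 \<phi>)
  consider "embedded \<phi>" | "\<not> embedded \<phi>" "distinct (map sink \<phi>)" | "\<not> distinct (map sink \<phi>)"
    by blast
  then show ?case
  proof cases
    case 1
    with emb "1.prems" show ?thesis by simp
  next
    case 2
    then obtain a where "\<phi> = [a, reverse_edge a]"
      using backtracking_loop "1.prems" by blast
    then show ?thesis by (simp add: path_integral_def agreement_sign_reverse)
  next
    case 3
    then obtain \<psi> \<theta> where "edge_loop E \<psi>" "edge_loop E \<theta>"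
      "length \<psi> < length \<phi>" "length \<theta> < length \<phi>"
      "path_integral F \<phi> = path_integral F \<psi> + path_integral F \<theta>"
      by (rule split_loop[OF "1.prems"])
    with "1.IH" show ?thesis by simp
  qed
qed


section \<open>Path independence and potentials\<close>

lemma path_independent_if_loops_vanish:
  assumes loops: "\<And>\<phi>. edge_loop E \<phi> \<Longrightarrow> path_integral F \<phi> = 0"
    and "edge_path E \<phi>" "joins \<phi> v w" "edge_path E \<psi>" "joins \<psi> v w"
  shows "path_integral F \<phi> = path_integral F \<psi>"
proof -
  have "edge_loop E (\<phi> @ reverse_path \<psi>)"
    using edge_path_join[OF assms(2,3) edge_path_reverse[OF assms(4)]
        joins_reverse[OF edge_path_nonempty[OF assms(4)] assms(5)]]
    by (auto simp: edge_loop_iff_joins)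
  from loops[OF this] show ?thesis
    by (simp add: path_integral_append path_integral_reverse)
qed

definition potential :: "('n::finite) curve set \<Rightarrow> 'n cvf \<Rightarrow> (real^'n \<Rightarrow> real) \<Rightarrow> bool" where
  "potential E F f \<longleftrightarrow>
     (\<forall>e\<in>E. path_integral F [(e, Along)] = f (pathfinish e) - f (pathstart e))"

lemma potential_oriented_edge:
  assumes "potential E F f" "fst a \<in> E"
  shows "path_integral F [a] = f (sink a) - f (source a)"
proof (cases a rule: reverse_edge.cases)
  case (1 e)
  then show ?thesis using assms by (simp add: potential_def)
next
  case (2 e)
  then have "path_integral F [a] = - path_integral F [(e, Along)]"
    using path_integral_reverse[of F "[(e, Along)]"] by (simp add: reverse_path_def)
  then show ?thesis using assms 2 by (simp add: potential_def)
qed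

lemma path_integral_potential:
  assumes pot: "potential E F f" and "edge_path E \<phi>"
  shows "path_integral F \<phi> = f (sink (last \<phi>)) - f (source (hd \<phi>))"
  using assms(2)
proof (induction \<phi>)
  case Nil
  then show ?case by (simp add: edge_path_def)
next
  case (Cons a \<phi>)
  show ?case
  proof (cases "\<phi> = []")
    case True
    then show ?thesis
      using Cons.prems potential_oriented_edge[OF pot] by (simp add: edge_path_single)
  next
    case False
    then have "fst a \<in> E" "edge_path E \<phi>" "sink a = source (hd \<phi>)"
      using Cons.prems edge_path_append[of "[a]" \<phi> E] by (auto simp: edge_path_single)
    then show ?thesis
      using False Cons.IH potential_oriented_edge[OF pot] path_integral_append[of F "[a]" \<phi>]
      by simp
  qed
qed

text \<open>The potential integrates from a base point. As the graph may be disconnected, the base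
  point is picked from the set of points joined to the given one; adjacent vertices have the
  same such set and hence the same base point. Edge paths being nonempty, a vertex reaches
  itself by going along an edge and back.\<close>

lemma potential_exists:
  assumes indep: "\<And>\<phi> \<psi> v w. \<lbrakk>edge_path E \<phi>; joins \<phi> v w; edge_path E \<psi>; joins \<psi> v w\<rbrakk>
                    \<Longrightarrow> path_integral F \<phi> = path_integral F \<psi>"
  shows "\<exists>f. potential E F f"
proof -
  define linked where "linked v = {u. \<exists>\<phi>. edge_path E \<phi> \<and> joins \<phi> u v}" for v
  define base where "base v = (SOME u. u \<in> linked v)" for v
  define f where
    "f v = path_integral F (SOME \<phi>. edge_path E \<phi> \<and> joins \<phi> (base v) v)" for v
  have f_eq: "f v = path_integral F \<phi>" if "edge_path E \<phi>" "joins \<phi> (base v) v" for \<phi> v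
  proof -
    have "edge_path E (SOME \<phi>. edge_path E \<phi> \<and> joins \<phi> (base v) v) \<and>
          joins (SOME \<phi>. edge_path E \<phi> \<and> joins \<phi> (base v) v) (base v) v"
      using that by (intro someI[where P = "\<lambda>\<phi>. edge_path E \<phi> \<and> joins \<phi> (base v) v"]) simp
    then show ?thesis unfolding f_def using indep that by blast
  qed
  have "path_integral F [(e, Along)] = f (pathfinish e) - f (pathstart e)" if "e \<in> E" for e
  proof -
    let ?v = "pathstart e" and ?w = "pathfinish e"
    have along: "edge_path E [(e, Along)]" "joins [(e, Along)] ?v ?w"
      and against: "edge_path E [(e, Against)]" "joins [(e, Against)] ?w ?v"
      using that by (auto simp: edge_path_single joins_def)
    have "linked ?v = linked ?w"
      unfolding linked_def using edge_path_join[OF _ _ along] edge_path_join[OF _ _ against]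
      by blast
    then have base_eq: "base ?w = base ?v" by (simp add: base_def)
    have "?w \<in> linked ?v" using against by (auto simp: linked_def)
    then have "base ?v \<in> linked ?v" unfolding base_def by (rule someI)
    then obtain \<phi> where \<phi>: "edge_path E \<phi>" "joins \<phi> (base ?v) ?v"
      by (auto simp: linked_def)
    have "f ?w = path_integral F (\<phi> @ [(e, Along)])"
      using edge_path_join[OF \<phi> along] by (intro f_eq) (simp_all add: base_eq)
    then show ?thesis by (simp add: path_integral_append f_eq[OF \<phi>])
  qed
  then show ?thesis by (auto simp: potential_def)
qed

text \<open>A tilt of \<open>f\<close> directs every edge uphill, whereas a potential refers to the parametrization.
  Passing between the two changes directions and signs simultaneously, which is what
  equivalence of fields allows.\<close>

lemma tilt_iff_potential:
  "(\<exists>T. is_tilt E f T \<and> cvf_equiv E F T) \<longleftrightarrow> potential E F f"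
proof
  assume "\<exists>T. is_tilt E f T \<and> cvf_equiv E F T"
  then obtain T where T: "is_tilt E f T" "cvf_equiv E F T" by blast
  show "potential E F f"
    unfolding potential_def
  proof
    fix e assume "e \<in> E"
    with T show "path_integral F [(e, Along)] = f (pathfinish e) - f (pathstart e)"
      by (cases "orientation T e"; cases "orientation F e")
        (auto simp: is_tilt_def cvf_equiv_def path_integral_def Let_def)
  qed
next
  assume pot: "potential E F f"
  define T :: "'a cvf" where "T =
    \<lparr>orientation = (\<lambda>e. if f (pathstart e) \<le> f (pathfinish e) then Along else Against),
     strength = (\<lambda>e. \<bar>f (pathfinish e) - f (pathstart e)\<bar>)\<rparr>"
  have "is_tilt E f T" by (auto simp: is_tilt_def T_def Let_def)
  moreover have "cvf_equiv E F T"
    unfolding cvf_equiv_def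
  proof
    fix e assume "e \<in> E"
    then have "path_integral F [(e, Along)] = f (pathfinish e) - f (pathstart e)"
      using pot by (simp add: potential_def)
    then show "(orientation F e = orientation T e \<longrightarrow> strength F e = strength T e) \<and>
               (orientation F e \<noteq> orientation T e \<longrightarrow> strength F e = - strength T e)"
      by (cases "orientation F e") (auto simp: T_def path_integral_def)
  qed
  ultimately show "\<exists>T. is_tilt E f T \<and> cvf_equiv E F T" by blast
qed


section \<open>Conservative combinatorial vector fields\<close>

theorem mainTheorem1:
  fixes S V :: "(real^'n) set" and E :: "'n curve set" and F :: "'n cvf"
  assumes "combinatorial_surface S V E"
  shows
    "((\<forall>\<phi>. edge_loop E \<phi> \<and> embedded \<phi> \<longrightarrow> path_integral F \<phi> = 0) \<longleftrightarrow>
      (\<forall>\<phi>. edge_loop E \<phi> \<longrightarrow> path_integral F \<phi> = 0)) \<and>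
     ((\<forall>\<phi>. edge_loop E \<phi> \<longrightarrow> path_integral F \<phi> = 0) \<longleftrightarrow>
      (\<forall>v\<in>V. \<forall>w\<in>V. \<forall>\<phi> \<psi>. edge_path E \<phi> \<and> joins \<phi> v w \<and> edge_path E \<psi> \<and> joins \<psi> v w \<longrightarrow>
         path_integral F \<phi> = path_integral F \<psi>)) \<and>
     ((\<forall>v\<in>V. \<forall>w\<in>V. \<forall>\<phi> \<psi>. edge_path E \<phi> \<and> joins \<phi> v w \<and> edge_path E \<psi> \<and> joins \<psi> v w \<longrightarrow>
         path_integral F \<phi> = path_integral F \<psi>) \<longleftrightarrow>
      (\<exists>f T. is_tilt E f T \<and> cvf_equiv E F T))"
proof -
  let ?embedded_vanish = "\<forall>\<phi>. edge_loop E \<phi> \<and> embedded \<phi> \<longrightarrow> path_integral F \<phi> = 0"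
  let ?loops_vanish = "\<forall>\<phi>. edge_loop E \<phi> \<longrightarrow> path_integral F \<phi> = 0"
  let ?independent = "\<forall>v\<in>V. \<forall>w\<in>V. \<forall>\<phi> \<psi>. edge_path E \<phi> \<and> joins \<phi> v w \<and> edge_path E \<psi> \<and> joins \<psi> v w \<longrightarrow>
         path_integral F \<phi> = path_integral F \<psi>"
  let ?tilt = "\<exists>f T. is_tilt E f T \<and> cvf_equiv E F T"

  have "path_image e \<inter> V = {pathstart e, pathfinish e}" if "e \<in> E" for e
    using assms that by (simp add: combinatorial_surface_def)
  then have "pathstart e \<in> V" "pathfinish e \<in> V" if "e \<in> E" for e
    using that by blast+
  then have source_in_V: "source a \<in> V" if "fst a \<in> E" for a
    using that by (cases a rule: reverse_edge.cases) auto

  have embedded_iff: "?embedded_vanish \<longleftrightarrow> ?loops_vanish"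
    using loops_vanish_if_embedded_vanish by blast
  have independent_if_loops: "?independent" if ?loops_vanish
    using path_independent_if_loops_vanish that by blast
  have loops_if_independent: "?loops_vanish" if ind: ?independent
  proof (intro allI impI)
    fix \<phi> assume "edge_loop E \<phi>"
    then obtain v where \<phi>: "edge_path E \<phi>" "joins \<phi> v v"
      by (auto simp: edge_loop_iff_joins)
    have "fst (hd \<phi>) \<in> E" using \<phi>(1) by (auto simp: edge_path_def)
    then have "v \<in> V" using source_in_V[of "hd \<phi>"] \<phi>(2) by (simp add: joins_def)
    then have "path_integral F (\<phi> @ \<phi>) = path_integral F \<phi>"
      using ind \<phi> edge_path_join[OF \<phi> \<phi>] by blast
    then show "path_integral F \<phi> = 0" by (simp add: path_integral_append)
  qed
  have tilt_if_independent: "?tilt" if ?independent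
  proof -
    have "\<exists>f. potential E F f"
      using path_independent_if_loops_vanish loops_if_independent[OF that]
      by (intro potential_exists) blast
    then show ?thesis by (simp add: tilt_iff_potential)
  qed
  have independent_if_tilt: "?independent" if tilt: ?tilt
  proof -
    obtain f where "potential E F f" using tilt unfolding tilt_iff_potential by blast
    from path_integral_potential[OF this] show ?thesis by (auto simp: joins_def)
  qed
  have "?loops_vanish \<longleftrightarrow> ?independent"
    by (rule iffI) (erule independent_if_loops, erule loops_if_independent)
  moreover have "?independent \<longleftrightarrow> ?tilt"
    by (rule iffI) (erule tilt_if_independent, erule independent_if_tilt)
  ultimately show ?thesis by (intro conjI embedded_iff)
qed

end
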